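(* For $k\ge2$ and $z$ in the upper half-plane $\mathbb{H}=\{x+iy: y>0\}$, let $G_{2k}(z)=\sum_{(m,n)\in\mathbb{Z}^2\setminus\{(0,0)\}}(mz+n)^{-2k}$ be the Eisenstein series. Then for every integer $n\ge1$ and all $z\in\mathbb{H}$, $$G_{6n+2}(z)=\frac{1}{6n+1}\cdot\frac{(4n+1)!}{((2n)!)^2}\sum_{k=1}^n\frac{\binom{2n}{2k-1}}{\binom{6n}{2n+2k-1}}\,G_{2n+2k}(z)\,G_{4n-2k+2}(z).$$ *)

theory Defs imports "HOL-Analysis.Analysis" begin

text \<open>The index \<open>w\<close> is the weight, so \<open>eisenstein_G (2 * k)\<close> is $G_{2k}$. The sum is
  unordered; it converges for \<open>w \<ge> 3\<close> and \<open>z\<close> in the upper half-plane, and \<open>infsum\<close> returns the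
  junk value 0 where it does not.\<close>

definition eisenstein_G :: "nat \<Rightarrow> complex \<Rightarrow> complex" where
  "eisenstein_G w z =
     (\<Sum>\<^sub>\<infinity>(m, n) \<in> (UNIV :: (int \<times> int) set) - {(0, 0)}. 1 / (of_int m * z + of_int n) ^ w)"

end

theory Submission imports Defs begin

text \<open>Put \<open>N = 2n\<close> and
  \<open>f u v = (\<Sum>i. (-1)^i * (i choose N) * (3N - i choose N) / (u^(i+1) * v^(3N-i+1)))\<close>. If
  \<open>u + v + w = 0\<close>, then \<open>f u v + f v w + f w u = 0\<close>: up to a constant, \<open>f u v\<close> is the coefficient of
  \<open>a^N b^N c^N\<close> in the expansion of \<open>1 / ((u + a - c) * (v + b - a))\<close>, and the cyclic sum of these
  products is \<open>(u + v + w) / ((u + a - c) * (v + b - a) * (w + c - b)) = 0\<close>.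
  Summing over all nonzero lattice points with \<open>u + v + w = 0\<close>, the three terms contribute equally, so
  the sum of \<open>f u v\<close> over nonzero \<open>u, v\<close> with \<open>u + v \<noteq> 0\<close> vanishes. Adding the terms with
  \<open>v = - u\<close> turns this into a relation between the products \<open>G_(i+1) * G_(3N-i+1)\<close> and \<open>G_(3N+2)\<close>.
  Only \<open>N \<le> i \<le> 2N\<close> occur, so all series converge absolutely, and the odd weights drop out.\<close>

subsection \<open>A rational function with vanishing cyclic sum\<close>

lemma complete_homogeneous_cyclic_sum:
  fixes U V W s t r :: "'a::comm_ring_1"
  assumes UVW: "U * V + V * W + W * U = 0" and str: "s + t + r = 0"
  shows "U * V * (\<Sum>i\<le>n. (s * U) ^ i * (t * V) ^ (n - i)) +
         V * W * (\<Sum>i\<le>n. (t * V) ^ i * (r * W) ^ (n - i)) +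
         W * U * (\<Sum>i\<le>n. (r * W) ^ i * (s * U) ^ (n - i)) = 0"
proof -
  \<comment> \<open>In generating functions: \<open>U V / ((1 - s U X) (1 - t V X))\<close> and its cyclic shifts, over the
    common denominator, have numerator \<open>U V + V W + W U - (s + t + r) U V W X\<close>.\<close>
  define geo :: "'a \<Rightarrow> 'a fps" where "geo x = Abs_fps (\<lambda>k. x ^ k)" for x
  have geo: "(1 - fps_const x * fps_X) * geo x = 1" for x
  proof (rule fps_ext)
    fix k show "fps_nth ((1 - fps_const x * fps_X) * geo x) k = fps_nth 1 k"
      by (cases k) (auto simp: geo_def left_diff_distrib mult.assoc)
  qed
  have nth: "fps_nth (geo x * geo y) n = (\<Sum>i\<le>n. x ^ i * y ^ (n - i))" for x y
    by (simp add: geo_def fps_mult_nth atLeast0AtMost)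
  define A where "A = geo (s * U)"
  define B where "B = geo (t * V)"
  define C where "C = geo (r * W)"
  \<comment> \<open>\<open>geo x\<close> is a true inverse of
    \<open>1 - fps_const x * fps_X\<close>, so passing to a common denominator means multiplying
    each term by its missing factor times the inverse of that factor, which is 1.\<close>
  have "fps_const (U * V) * (A * B) + fps_const (V * W) * (B * C) + fps_const (W * U) * (C * A) = 
    fps_const (U * V) * (A * B) * ((1 - fps_const (r * W) * fps_X) * C) +
    fps_const (V * W) * (B * C) * ((1 - fps_const (s * U) * fps_X) * A) +
    fps_const (W * U) * (C * A) * ((1 - fps_const (t * V) * fps_X) * B)"
    unfolding A_def B_def C_def geo by simp
  also have "\<dots> = A * B * C * (fps_const (U * V + V * W + W * U) -
      fps_const (U * V * W * (s + t + r)) * fps_X)"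
    by (simp add: algebra_simps flip: fps_const_add fps_const_mult)
  also have "\<dots> = 0" by (simp add: UVW str)
  finally have "fps_nth (fps_const (U * V) * (A * B) + fps_const (V * W) * (B * C) + fps_const (W * U) * (C * A)) n = 0"
    by simp
  then show ?thesis by (simp add: A_def B_def C_def nth)
qed

section \<open>Binomial identities for the coefficients\<close>

text \<open>This is a \<open>q\<close>-fold backward difference in \<open>M\<close>; by Pascal's
  rule each difference turns \<open>M choose K\<close> into \<open>(M - 1) choose (K - 1)\<close>.
  For \<open>K < q\<close> the truncated \<open>K - q\<close> would give 1 instead of 0, hence the
  case distinction.\<close>

lemma alternating_sum_choose_diff:
  assumes "q \<le> M"
  shows "(\<Sum>p\<le>q. (-1) ^ p * of_nat (q choose p) * of_nat ((M - p) choose K)) =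
         (if q \<le> K then of_nat ((M - q) choose (K - q)) else (0::'a::comm_ring_1))"
  using assms
proof (induction q arbitrary: M K)
  case 0 then show ?case by simp
next
  case (Suc q)
  then obtain M' where M: "M = Suc M'" and q: "q \<le> M'" by (metis Suc_le_D Suc_le_mono)
  let ?S = "\<lambda>M K. (\<Sum>p\<le>q. (-1) ^ p * of_nat (q choose p) * of_nat ((M - p) choose K)) :: 'a"
  \<comment> \<open>Pascal's rule splits \<open>Suc q choose p\<close>. The part with
    \<open>p - 1\<close>, shifted by one, is the negated sum for \<open>M'\<close>, so a difference
    in \<open>M\<close> appears, and Pascal's rule lowers \<open>K\<close> in it.\<close>
  have "(\<Sum>p\<le>Suc q. (-1) ^ p * of_nat (Suc q choose p) * of_nat ((M - p) choose K)) =
        (\<Sum>p\<le>Suc q. (-1) ^ p * of_nat (q choose p) * of_nat ((M - p) choose K)) +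
        (\<Sum>p\<le>Suc q. (if p = 0 then 0 else (-1) ^ p * of_nat (q choose (p - 1)) * of_nat ((M - p) choose K)) :: 'a)"
    unfolding sum.distrib[symmetric]
    by (intro sum.cong refl) (auto simp: algebra_simps gr0_conv_Suc)
  also have "(\<Sum>p\<le>Suc q. (if p = 0 then 0 else (-1) ^ p * of_nat (q choose (p - 1)) * of_nat ((M - p) choose K)) :: 'a)
     = - ?S M' K"
    by (subst sum.atMost_Suc_shift) (simp add: M sum_negf)
  also have "(\<Sum>p\<le>Suc q. (-1) ^ p * of_nat (q choose p) * of_nat ((M - p) choose K) :: 'a) = ?S M K"
    by (simp add: binomial_eq_0)
  also have "?S M K + - ?S M' K = (\<Sum>p\<le>q. (-1) ^ p * of_nat (q choose p) *
      (of_nat ((M - p) choose K) - of_nat ((M' - p) choose K)))"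
    by (simp add: sum_subtractf algebra_simps)
  also have "\<dots> = (case K of 0 \<Rightarrow> 0 | Suc K' \<Rightarrow> ?S M' K')"
    by (cases K) (use q in \<open>auto simp: M Suc_diff_le intro!: sum.cong sum.neutral\<close>)
  finally show ?case using Suc.IH[OF q]
    by (auto simp: M split: nat.splits)
qed


text \<open>Both sides count the subsets of \<open>{0..m}\<close> with \<open>a + b + 1\<close>
  elements; the left side sorts them by the member \<open>i\<close> that has \<open>a\<close>
  members below it and \<open>b\<close> above it.\<close>

lemma sum_choose_mult_choose:
  "(\<Sum>i\<le>m. (i choose a) * ((m - i) choose b)) = Suc m choose Suc (a + b)"
proof (induction m arbitrary: b)
  case 0
  show ?case by (cases a; cases b) auto
next
  case (Suc m)
  have "(\<Sum>i\<le>Suc m. (i choose a) * ((Suc m - i) choose b)) =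
    (\<Sum>i\<le>m. (i choose a) * ((Suc m - i) choose b)) + (Suc m choose a) * (0 choose b)"
    by simp
  also have "\<dots> = Suc (Suc m) choose Suc (a + b)"
  proof (cases b)
    case 0
    then show ?thesis using Suc.IH[of 0] by simp
  next
    case (Suc b')
    have "(\<Sum>i\<le>m. (i choose a) * ((Suc m - i) choose b)) =
      (\<Sum>i\<le>m. (i choose a) * ((m - i) choose b')) + (\<Sum>i\<le>m. (i choose a) * ((m - i) choose b))"
      unfolding sum.distrib[symmetric]
      by (intro sum.cong refl) (auto simp: Suc Suc_diff_le algebra_simps)
    then show ?thesis using Suc.IH[of b'] Suc.IH[of b] by (simp add: Suc)
  qed
  finally show ?case .
qed

definition cyc_coeff :: "nat \<Rightarrow> nat \<Rightarrow> 'a::comm_ring_1" where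
  "cyc_coeff N i = (-1) ^ i * of_nat ((i choose N) * ((3 * N - i) choose N))"

lemma cyc_coeff_eq_0:
  assumes "i < N \<or> 2 * N < i" "i \<le> 3 * N"
  shows "cyc_coeff N i = 0"
  using assms by (auto simp: cyc_coeff_def binomial_eq_0)

lemma cyc_coeff_flip:
  assumes "even N" "i \<le> 3 * N"
  shows "cyc_coeff N (3 * N - i) = cyc_coeff N i"
  using assms by (simp add: cyc_coeff_def minus_one_power_iff mult.commute[of "of_nat (i choose N)"])

text \<open>Since \<open>(j choose m) * (m choose N)\<close> equals
  \<open>(j choose N) * ((j - N) choose (m - N))\<close>, the sum is a backward difference of order
  \<open>j - N\<close>. It serves as invariance, under replacing X by -(1 + X), of the linear
  functional that sends X^m to \<open>cyc_coeff N m\<close>.\<close>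

lemma cyc_coeff_binomial_transform:
  assumes "even N" "j \<le> 3 * N"
  shows "(\<Sum>m\<le>j. of_nat (j choose m) * cyc_coeff N m) = (-1) ^ j * cyc_coeff N j"
proof (cases "N \<le> j")
  case False
  then show ?thesis by (auto simp: cyc_coeff_def binomial_eq_0 intro!: sum.neutral)
next
  case True
  define q where "q = j - N"
  have j: "j = N + q" and q: "q \<le> 2 * N" using True assms by (auto simp: q_def)
  have "(\<Sum>m\<le>j. of_nat (j choose m) * cyc_coeff N m) = (\<Sum>m\<in>{N..j}. of_nat (j choose m) * cyc_coeff N m :: 'a)"
    by (rule sum.mono_neutral_right) (auto simp: cyc_coeff_def binomial_eq_0)
  also have "\<dots> = (\<Sum>p\<le>q. of_nat (j choose (p + N)) * cyc_coeff N (p + N))"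
    using sum.shift_bounds_cl_nat_ivl[of "\<lambda>m. of_nat (j choose m) * cyc_coeff N m :: 'a" 0 N q]
    by (simp add: j add.commute atLeast0AtMost)
  also have "\<dots> = (\<Sum>p\<le>q. of_nat (j choose N) * ((-1) ^ p * of_nat (q choose p) * of_nat ((2 * N - p) choose N)))"
  proof (intro sum.cong refl)
    fix p assume "p \<in> {..q}"
    then have "(j choose (p + N)) * ((p + N) choose N) = (j choose N) * (q choose p)"
      using choose_mult[of N "p + N" j] by (simp add: j)
    then have *: "of_nat (j choose (p + N)) * of_nat ((p + N) choose N) = (of_nat (j choose N) * of_nat (q choose p) :: 'a)"
      by (metis of_nat_mult)
    have "of_nat (j choose (p + N)) * cyc_coeff N (p + N) =
      of_nat (j choose (p + N)) * of_nat ((p + N) choose N) * ((-1) ^ p * of_nat ((2 * N - p) choose N) :: 'a)"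
      using assms(1) by (simp add: cyc_coeff_def power_add algebra_simps)
    then show "of_nat (j choose (p + N)) * cyc_coeff N (p + N) =
      (of_nat (j choose N) * ((-1) ^ p * of_nat (q choose p) * of_nat ((2 * N - p) choose N)) :: 'a)"
      unfolding * by (simp add: algebra_simps)
  qed
  \<comment> \<open>Here \<open>2 * N - q = 3 * N - j\<close>. For \<open>q \<le> N\<close>,
    symmetry replaces \<open>N - q\<close> by its complement \<open>N\<close>; for
    \<open>q > N\<close> the top entry is below \<open>N\<close> and both sides vanish.\<close>
  also have "\<dots> = of_nat (j choose N) * of_nat ((3 * N - j) choose N)"
  proof (cases "q \<le> N")
    case True
    then have "(2 * N - q) choose (N - q) = (3 * N - j) choose N"
      using binomial_symmetric[of "N - q" "2 * N - q"] by (simp add: j)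
    then show ?thesis using q True
      by (simp add: sum_distrib_left[symmetric] alternating_sum_choose_diff)
  next
    case False
    then show ?thesis using q
      by (simp add: sum_distrib_left[symmetric] alternating_sum_choose_diff binomial_eq_0 j)
  qed
  also have "\<dots> = (-1) ^ j * cyc_coeff N j"
    by (simp add: cyc_coeff_def minus_one_power_iff)
  finally show ?thesis .
qed

section \<open>Vanishing of the cyclic sum\<close>

text \<open>In the reciprocals U = 1/u, V = 1/v, W = 1/w the relation u + v + w = 0 becomes the
  hypothesis, and the claim becomes a polynomial identity.\<close>

lemma cyclic_sum_eq_0:
  fixes U V W :: "'a::comm_ring_1"
  assumes N: "even N" and UVW: "U * V + V * W + W * U = 0"
  defines "f \<equiv> \<lambda>x y. \<Sum>i\<le>3 * N. cyc_coeff N i * (x ^ Suc i * y ^ Suc (3 * N - i))"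
  shows "f U V + f V W + f W U = 0"
proof -
  define M where "M = 3 * N"
  define L :: "'a poly \<Rightarrow> 'a" where "L p = (\<Sum>m\<le>M. coeff p m * cyc_coeff N m)" for p
  have L_add: "L (p + q) = L p + L q" for p q
    by (simp add: L_def sum.distrib algebra_simps)
  have L_smult: "L (smult a p) = a * L p" for a p
    by (simp add: L_def sum_distrib_left algebra_simps)
  have L_0: "L 0 = 0" by (simp add: L_def)
  have L_sum: "L (sum p {..k}) = (\<Sum>i\<le>k. L (p i))" for p and k :: nat
    by (induction k) (simp_all add: L_add)
  \<comment> \<open>Apply \<open>L\<close>, which sends \<open>X ^ i\<close> to the coefficient \<open>cyc_coeff N i\<close>, to the identity for complete
    homogeneous sums with \<open>s = X\<close>, \<open>t = 1\<close>, \<open>r = Y\<close>: it takes the same values on \<open>X ^ i\<close>,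
    \<open>Y ^ (3N - i)\<close> and \<open>Y ^ i * X ^ (3N - i)\<close>.\<close>
  define X :: "'a poly" where "X = [:0, 1:]"
  have L_X: "L (X ^ i) = cyc_coeff N i" if "i \<le> M" for i
  proof -
    have "X ^ i = monom 1 i" by (simp add: X_def monom_altdef)
    then have "L (X ^ i) = (\<Sum>m\<le>M. if m = i then cyc_coeff N m else 0)"
      unfolding L_def by (intro sum.cong refl) auto
    then show ?thesis using that by simp
  qed
  \<comment> \<open>The choice that makes the three multipliers X, 1, Y add up to 0. Powers of
    \<open>Y\<close> expand by the binomial theorem, so \<open>L\<close> turns them into binomial
    transforms.\<close>
  define Y where "Y = - (1 + X)"
  have coeff_binomial: "coeff ([:1, 1:] ^ j) m = (of_nat (j choose m) :: 'a)" for j m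
  proof (cases "m \<le> j")
    case True
    then show ?thesis by (simp add: coeff_linear_poly_power)
  next
    case False
    moreover have "degree ([:1, 1:: 'a:] ^ j) \<le> j"
      using degree_power_le[of "[:1, 1:: 'a:]" j] by simp
    ultimately show ?thesis by (simp add: coeff_eq_0 binomial_eq_0)
  qed
  have neg_power: "Y ^ j = smult ((-1) ^ j) ([:1, 1:] ^ j)" for j
  proof -
    have "Y = smult (-1) [:1, 1:]" by (simp add: X_def Y_def one_pCons)
    then show ?thesis by (simp only: smult_power)
  qed
  have sign: "(-1) ^ j * ((-1) ^ j * c) = c" for j and c :: 'a
    by (simp add: minus_one_power_iff)
  have L_1: "L (Y ^ j) = cyc_coeff N j" if "j \<le> M" for j
  proof -
    have "L ([:1, 1:] ^ j) = (\<Sum>m\<le>j. of_nat (j choose m) * cyc_coeff N m)"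
      unfolding L_def using that
      by (intro sum.mono_neutral_cong_right) (auto simp: coeff_binomial binomial_eq_0)
    then show ?thesis using that N
      by (simp add: neg_power L_smult cyc_coeff_binomial_transform M_def sign)
  qed
  have L_2: "L (Y ^ j * X ^ (M - j)) = cyc_coeff N j" if "j \<le> M" for j
  proof -
    have X: "X ^ (M - j) = monom 1 (M - j)"
      by (simp add: X_def monom_altdef)
    have "L (monom 1 (M - j) * [:1, 1:] ^ j) =
        (\<Sum>m\<in>{M - j..M}. of_nat (j choose (m - (M - j))) * cyc_coeff N m)"
      unfolding L_def
      by (intro sum.mono_neutral_cong_right) (auto simp: coeff_monom_mult coeff_binomial)
    \<comment> \<open>Reversing \<open>m\<close> to \<open>M - m\<close> preserves both
      \<open>cyc_coeff\<close> and, by symmetry, the binomial coefficient, and leads back to the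
      transform already evaluated.\<close>
    also have "\<dots> = (\<Sum>m\<le>j. of_nat (j choose m) * cyc_coeff N m)"
    proof (rule sum.reindex_bij_witness[of _ "\<lambda>m. M - m" "\<lambda>m. M - m"])
      fix a assume a: "a \<in> {M - j..M}"
      then have "j choose (a - (M - j)) = j choose (M - a)"
        using that binomial_symmetric[of "M - a" j] by (auto simp: add.commute)
      moreover have "cyc_coeff N (M - a) = (cyc_coeff N a :: 'a)"
        using a N by (simp add: M_def cyc_coeff_flip)
      ultimately show "of_nat (j choose (M - a)) * cyc_coeff N (M - a) =
          (of_nat (j choose (a - (M - j))) * cyc_coeff N a :: 'a)"
        by simp
    qed (use that in auto)
    finally have "L (monom 1 (M - j) * [:1, 1:] ^ j) = (-1) ^ j * cyc_coeff N j"
      using that N by (simp add: cyc_coeff_binomial_transform M_def)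
    then show ?thesis
      unfolding neg_power X by (simp add: L_smult mult.commute[of _ "monom _ _"] sign)
  qed
  have eq: "smult (U * V) (\<Sum>i\<le>M. smult (U ^ i * V ^ (M - i)) (X ^ i)) +
      smult (V * W) (\<Sum>i\<le>M. smult (V ^ i * W ^ (M - i)) (Y ^ (M - i))) +
      smult (W * U) (\<Sum>i\<le>M. smult (W ^ i * U ^ (M - i)) (Y ^ i * X ^ (M - i))) = 0"
  proof -
    have c: "[:U:] * [:V:] + [:V:] * [:W:] + [:W:] * [:U:] = 0" using UVW by (simp add: mult.commute)
    have P: "(p * [:a:]) ^ i * (q * [:b:]) ^ k = smult (a ^ i * b ^ k) (p ^ i * q ^ k)"
      for a b :: 'a and p q i k
    proof -
      have "(p * [:a:]) ^ i = smult (a ^ i) (p ^ i)" for a :: 'a and p i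
        by (simp add: smult_power)
      then show ?thesis by (simp add: mult.commute)
    qed
    have S: "[:a:] * [:b:] * p = smult (a * b) p" for a b :: 'a and p
      by (simp add: mult.commute)
    have "X + 1 + Y = 0" by (simp add: Y_def)
    from complete_homogeneous_cyclic_sum[OF c this, of M] show ?thesis
      unfolding P S unfolding power_one mult_1_left mult_1_right .
  qed
  have f: "f x y = x * y * (\<Sum>i\<le>M. x ^ i * y ^ (M - i) * cyc_coeff N i)" for x y
    unfolding f_def M_def sum_distrib_left by (intro sum.cong refl) (simp add: ac_simps)
  have L_comb: "L (smult c (\<Sum>i\<le>M. smult (a i) (p i))) = c * (\<Sum>i\<le>M. a i * cyc_coeff N i)"
    if "\<And>i. i \<le> M \<Longrightarrow> L (p i) = cyc_coeff N i" for a p c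
    unfolding L_smult L_sum using that by simp
  have flip: "L (Y ^ (M - i)) = cyc_coeff N i" if "i \<le> M" for i
    using that N L_1[of "M - i"] by (simp add: M_def cyc_coeff_flip)
  from arg_cong[OF eq, of L] show ?thesis
    by (simp only: f L_add L_0 L_comb L_X L_2 flip)
qed


subsection \<open>Absolute convergence\<close>

lemma has_sum_product:
  fixes f :: "'a \<Rightarrow> 'c::{banach, real_normed_div_algebra}" and g :: "'b \<Rightarrow> 'c"
  assumes f: "(\<lambda>x. norm (f x)) summable_on A" and g: "(\<lambda>y. norm (g y)) summable_on B"
  shows "((\<lambda>(x, y). f x * g y) has_sum (infsum f A * infsum g B)) (A \<times> B)"
proof -
  have "(\<lambda>p. norm (case p of (x, y) \<Rightarrow> f x * g y)) summable_on (A \<times> B)"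
    unfolding Infinite_Sum.abs_summable_on_Sigma_iff
    using f g by (auto simp: norm_mult infsum_cmult_right' abs_mult infsum_nonneg
      intro!: summable_on_cmult_right summable_on_cmult_left)
  then have "(\<lambda>(x, y). f x * g y) summable_on (A \<times> B)"
    by (rule abs_summable_summable)
  moreover from this have "infsum (\<lambda>(x, y). f x * g y) (A \<times> B) = infsum f A * infsum g B"
    by (simp add: infsum_Sigma_banach[symmetric] infsum_cmult_right' infsum_cmult_left')
  ultimately show ?thesis by (metis has_sum_infsum)
qed

lemma has_sum_sum:
  fixes f :: "'i \<Rightarrow> 'a \<Rightarrow> 'b::topological_comm_monoid_add"
  assumes "\<And>i. i \<in> I \<Longrightarrow> (f i has_sum s i) A"
  shows "((\<lambda>x. \<Sum>i\<in>I. f i x) has_sum (\<Sum>i\<in>I. s i)) A"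
  using assms by (induction I rule: infinite_finite_induct) (auto intro!: has_sum_add)

lemma summable_on_int_powr: 
  assumes "a > 1"
  shows "(\<lambda>m::int. (1 + \<bar>of_int m\<bar>) powr - a :: real) summable_on UNIV"
proof -
  let ?h = "\<lambda>m::int. (1 + \<bar>of_int m\<bar>) powr - a :: real"
  have "summable (\<lambda>n. real (Suc n) powr - a)"
    using assms summable_real_powr_iff[of "- a"] by (subst summable_Suc_iff) auto
  then have nat: "(\<lambda>n. real (Suc n) powr - a) summable_on UNIV"
    by (subst summable_on_UNIV_nonneg_real_iff) auto
  have "?h summable_on range int" "?h summable_on range (\<lambda>n. - int n)"
    using nat by (subst summable_on_reindex; auto simp: inj_def o_def)+
  then have "?h summable_on (range int \<union> range (\<lambda>n. - int n))"
    by (rule summable_on_union)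
  also have "range int \<union> range (\<lambda>n. - int n) = UNIV"
    by (auto simp: image_iff) (metis int_cases2)
  finally show ?thesis .
qed

text \<open>The imaginary part bounds |m| by a multiple of the norm, and the triangle inequality
  then bounds |n|. The product of square roots separates the variables, so that a double series can
  be dominated by a product of two single series.\<close>

lemma norm_lattice_point_lower_bound:
  fixes z :: complex
  assumes "Im z > 0"
  obtains c where "c > 0"
    "\<And>m n :: int. (m, n) \<noteq> (0, 0) \<Longrightarrow>
       c * (sqrt (1 + \<bar>of_int m\<bar>) * sqrt (1 + \<bar>of_int n\<bar>)) \<le> norm (of_int m * z + of_int n)"
proof
  \<comment> \<open>\<open>K\<close> is chosen so that |m| and |n| are both at most
    \<open>d * K\<close>. The 2 in \<open>c\<close> comes from \<open>1 + M \<le> 2 * M\<close>,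
    which holds as \<open>M \<ge> 1\<close>.\<close>
  define K where "K = 1 + (1 + norm z) / Im z"
  have "K > 0" using assms by (simp add: K_def add_pos_nonneg)
  define c where "c = 1 / (2 * K)"
  from \<open>K > 0\<close> show "c > 0" by (simp add: c_def)
  fix m n :: int assume mn: "(m, n) \<noteq> (0, 0)"
  define d where "d = norm (of_int m * z + of_int n)"
  define M :: real where "M = max \<bar>of_int m\<bar> \<bar>of_int n\<bar>"
  have "\<bar>of_int m\<bar> * Im z \<le> d"
    using abs_Im_le_cmod[of "of_int m * z + of_int n"] assms by (simp add: d_def abs_mult)
  then have m: "\<bar>of_int m\<bar> \<le> d / Im z" using assms by (simp add: field_simps)
  have d0: "d \<ge> 0" by (simp add: d_def)
  have "\<bar>of_int n\<bar> = norm ((of_int m * z + of_int n) - of_int m * z)" by simp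
  also have "\<dots> \<le> d + \<bar>of_int m\<bar> * norm z"
    unfolding d_def by (rule order_trans[OF norm_triangle_ineq4]) (simp add: norm_mult)
  also have "\<dots> \<le> d + d / Im z * norm z"
    using m by (intro add_mono mult_right_mono) auto
  finally have n: "\<bar>of_int n\<bar> \<le> d + d / Im z * norm z" .
  have "d / Im z \<ge> 0" "d / Im z * norm z \<ge> 0" using d0 assms by auto
  with m n d0 have "M \<le> d + d / Im z + d / Im z * norm z"
    unfolding M_def by linarith
  also have "\<dots> = d * K"
    by (simp add: K_def distrib_left add_divide_distrib)
  finally have M: "M \<le> d * K" .
  have "1 \<le> \<bar>m\<bar> \<or> 1 \<le> \<bar>n\<bar>" using mn by auto
  then have "1 \<le> M" unfolding M_def by (auto simp: le_max_iff_disj simp flip: of_int_abs)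
  have "sqrt (1 + \<bar>of_int m\<bar>) * sqrt (1 + \<bar>of_int n\<bar>) \<le> sqrt (1 + M) * sqrt (1 + M)"
    by (intro mult_mono) (auto simp: M_def)
  also have "\<dots> \<le> 2 * M" using \<open>1 \<le> M\<close> by simp
  also have "\<dots> \<le> d / c" using M by (simp add: c_def)
  finally show "c * (sqrt (1 + \<bar>of_int m\<bar>) * sqrt (1 + \<bar>of_int n\<bar>)) \<le> d"
    using \<open>c > 0\<close> by (simp add: field_simps)
qed

lemma eisenstein_abs_summable:
  fixes z :: complex
  assumes z: "Im z > 0" and w: "w \<ge> 3"
  shows "(\<lambda>p. norm (case p of (m, n) \<Rightarrow> 1 / (of_int m * z + of_int n) ^ w)) summable_on
           ((UNIV :: (int \<times> int) set) - {(0, 0)})"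
proof -
  obtain c where c: "c > 0" and bound: "\<And>m n :: int. (m, n) \<noteq> (0, 0) \<Longrightarrow>
       c * (sqrt (1 + \<bar>of_int m\<bar>) * sqrt (1 + \<bar>of_int n\<bar>)) \<le> norm (of_int m * z + of_int n)"
    using norm_lattice_point_lower_bound[OF z] by metis
  \<comment> \<open>The lower bound to the power 3 gives exponent 3/2 in each variable, which
    exceeds 1.\<close>
  let ?h = "\<lambda>m::int. (1 + \<bar>of_int m\<bar>) powr - (3/2) :: real"
  have "(\<lambda>m. norm (?h m)) summable_on UNIV" using summable_on_int_powr[of "3/2"] by simp
  from has_sum_imp_summable[OF has_sum_product[OF this this]]
  have "(\<lambda>(m, n). ?h m * ?h n) summable_on UNIV"
    by (simp only: UNIV_Times_UNIV)
  then have "(\<lambda>(m, n). ?h m * ?h n) summable_on (UNIV - {(0, 0)})"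
    by (rule summable_on_subset_banach) auto
  then have "(\<lambda>p. (1 / c) ^ w * (case p of (m, n) \<Rightarrow> ?h m * ?h n)) summable_on (UNIV - {(0, 0)})"
    by (rule summable_on_cmult_right)
  then show ?thesis
  proof (rule Infinite_Sum.abs_summable_on_comparison_test')
    fix p :: "int \<times> int" assume p: "p \<in> UNIV - {(0, 0)}"
    obtain m n where mn: "p = (m, n)" by (cases p)
    define a :: real where "a = 1 + \<bar>of_int m\<bar>"
    define b :: real where "b = 1 + \<bar>of_int n\<bar>"
    have ab: "a \<ge> 1" "b \<ge> 1" by (auto simp: a_def b_def)
    have half: "x powr - (3/2) = 1 / sqrt x ^ 3" if "x \<ge> 1" for x :: real
    proof -
      have "sqrt x ^ 3 = (x powr (1/2)) ^ 3" using that by (simp add: powr_half_sqrt)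
      also have "\<dots> = x powr (3/2)" using that by (subst powr_power) auto
      finally show ?thesis by (simp add: powr_minus_divide)
    qed
    have "1 \<le> sqrt a * sqrt b" using mult_mono[of 1 "sqrt a" 1 "sqrt b"] ab by simp
    \<comment> \<open>Only the factor \<open>sqrt a * sqrt b\<close>, which is at least 1, has its
      exponent lowered to 3; \<open>c\<close> may be below 1 and keeps the exponent
      \<open>w\<close>.\<close>
    have "c ^ w * (sqrt a * sqrt b) ^ 3 \<le> c ^ w * (sqrt a * sqrt b) ^ w"
      using c w \<open>1 \<le> sqrt a * sqrt b\<close> by (intro mult_left_mono power_increasing) auto
    also have "\<dots> = (c * (sqrt a * sqrt b)) ^ w" by (simp add: power_mult_distrib)
    also have "\<dots> \<le> norm (of_int m * z + of_int n) ^ w"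
      using bound[of m n] c p mn ab by (intro power_mono) (auto simp: a_def b_def)
    finally have "1 / norm (of_int m * z + of_int n) ^ w \<le> 1 / (c ^ w * (sqrt a * sqrt b) ^ 3)"
      using c ab by (intro divide_left_mono mult_pos_pos) (auto intro: less_le_trans[rotated])
    then show "norm (case p of (m, n) \<Rightarrow> 1 / (of_int m * z + of_int n) ^ w) \<le>
        (1 / c) ^ w * (case p of (m, n) \<Rightarrow> ?h m * ?h n)"
      using ab by (simp add: mn norm_divide norm_power half power_mult_distrib power_divide
        flip: a_def b_def)
  qed
qed

subsection \<open>Summation over the lattice\<close>

text \<open>The substitution of -u for u turns the sum into its own negative.\<close>

lemma lattice_power_sum_odd_eq_0:
  fixes \<Lambda> :: "complex set"
  assumes "\<And>u. u \<in> \<Lambda> \<Longrightarrow> - u \<in> \<Lambda>" and "odd w"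
  shows "(\<Sum>\<^sub>\<infinity>u\<in>\<Lambda> - {0}. 1 / u ^ w) = 0"
proof -
  have "(\<Sum>\<^sub>\<infinity>u\<in>\<Lambda> - {0}. 1 / u ^ w) = (\<Sum>\<^sub>\<infinity>u\<in>\<Lambda> - {0}. - (1 / u ^ w))"
    by (rule infsum_reindex_bij_witness[of _ uminus uminus])
      (use assms in \<open>auto simp: power_minus_odd\<close>)
  then show ?thesis by (simp add: infsum_uminus)
qed

lemma lattice_power_sum_relation:
  fixes \<Lambda> :: "complex set"
  assumes neg: "\<And>u. u \<in> \<Lambda> \<Longrightarrow> - u \<in> \<Lambda>"
    and add: "\<And>u v. u \<in> \<Lambda> \<Longrightarrow> v \<in> \<Lambda> \<Longrightarrow> u + v \<in> \<Lambda>"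
    and summable: "\<And>w. w \<ge> 3 \<Longrightarrow> (\<lambda>u. norm (1 / u ^ w)) summable_on (\<Lambda> - {0})"
    and N: "even N" "N \<ge> 2"
  defines "G \<equiv> \<lambda>w. \<Sum>\<^sub>\<infinity>u\<in>\<Lambda> - {0}. 1 / u ^ w"
  shows "(\<Sum>i=N..2*N. cyc_coeff N i * (G (Suc i) * G (Suc (3 * N - i)))) =
         - of_nat (Suc (3 * N) choose Suc (2 * N)) * G (3 * N + 2)"
proof -
  define S where "S = \<Lambda> - {0}"
  define f where "f u v = (\<Sum>i=N..2*N. cyc_coeff N i * (1 / u ^ Suc i * (1 / v ^ Suc (3 * N - i))))"
    for u v :: complex
  \<comment> \<open>A pair in \<open>T\<close> stands for a triple of nonzero points u, v, -u - v
    with sum 0.\<close>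
  define T where "T = {(u, v) \<in> S \<times> S. u + v \<noteq> 0}"
  define R where "R = (\<Sum>i=N..2*N. cyc_coeff N i * (G (Suc i) * G (Suc (3 * N - i))))"
  \<comment> \<open>The range \<open>0..3 * N\<close> fits the polynomial identity, the range
    \<open>N..2*N\<close> fits convergence; the extra coefficients are 0.\<close>
  have f_full: "f u v = (\<Sum>i\<le>3 * N. cyc_coeff N i * ((1 / u) ^ Suc i * (1 / v) ^ Suc (3 * N - i)))" for u v
    unfolding f_def power_one_over[symmetric]
    by (rule sum.mono_neutral_left) (auto simp: not_le intro!: cyc_coeff_eq_0)
  have cyclic: "f u v + f v (- u - v) + f (- u - v) u = 0" if "(u, v) \<in> T" for u v
  proof -
    have nz: "u \<noteq> 0" "v \<noteq> 0" "- u - v \<noteq> 0"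
      using that by (auto simp: T_def S_def)
    have "1 / u * (1 / v) + 1 / v * (1 / (- u - v)) + 1 / (- u - v) * (1 / u) =
        (u + v + (- u - v)) / (u * v * (- u - v))"
      using nz by (simp add: divide_simps del: minus_diff_eq)
    also have "\<dots> = 0" by simp
    finally show ?thesis
      unfolding f_full by (rule cyclic_sum_eq_0[OF N(1)])
  qed
  have total: "((\<lambda>(u, v). f u v) has_sum R) (S \<times> S)"
    unfolding f_def R_def split_def
  proof (intro has_sum_sum has_sum_cmult_right)
    \<comment> \<open>Both exponents are at least \<open>N + 1\<close>, hence at least 3, so both
      series converge absolutely.\<close>
    fix i assume i: "i \<in> {N..2*N}"
    have "((\<lambda>(u, v). 1 / u ^ Suc i * (1 / v ^ Suc (3 * N - i))) has_sum
        (G (Suc i) * G (Suc (3 * N - i)))) (S \<times> S)"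
      unfolding G_def S_def[symmetric]
      by (rule has_sum_product; unfold S_def; rule summable) (use i N in auto)
    then show "((\<lambda>p. 1 / fst p ^ Suc i * (1 / snd p ^ Suc (3 * N - i))) has_sum
        (G (Suc i) * G (Suc (3 * N - i)))) (S \<times> S)"
      by (simp only: split_def)
  qed
  have "(\<lambda>(u, v). f u v) summable_on T"
    by (rule summable_on_subset_banach[OF has_sum_imp_summable[OF total]]) (auto simp: T_def)
  then obtain I where I: "((\<lambda>(u, v). f u v) has_sum I) T"
    by (auto simp: summable_on_def)
  have S_cyc: "- u - v \<in> S" if "(u, v) \<in> T" for u v
    using that add[OF neg neg, of u v] by (auto simp: T_def S_def)
  have T_cyc: "(v, - u - v) \<in> T" "(- u - v, u) \<in> T" if "(u, v) \<in> T" for u v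
    using that S_cyc[OF that] by (auto simp: T_def S_def)
  \<comment> \<open>The map from (u, v) to (v, -u - v) permutes \<open>T\<close> with order three,
    so the three sums share the value \<open>I\<close>.\<close>
  have I2: "((\<lambda>(u, v). f v (- u - v)) has_sum I) T"
    using I by (subst has_sum_reindex_bij_witness[of T "\<lambda>(u, v). (- u - v, u)" "\<lambda>(u, v). (v, - u - v)" T])
      (auto intro: T_cyc)
  have I3: "((\<lambda>(u, v). f (- u - v) u) has_sum I) T"
    using I by (subst has_sum_reindex_bij_witness[of T "\<lambda>(u, v). (v, - u - v)" "\<lambda>(u, v). (- u - v, u)" T])
      (auto intro: T_cyc)
  have "((\<lambda>(u, v). f u v + f v (- u - v) + f (- u - v) u) has_sum (I + I + I)) T"
    using has_sum_add[OF has_sum_add[OF I I2] I3] by (simp only: split_def)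
  then have "((\<lambda>_. 0) has_sum (I + I + I)) T"
    by (rule has_sum_cong[THEN iffD1, rotated]) (use cyclic in \<open>simp add: split_def\<close>)
  from infsumI[OF this] have "3 * I = 0" by simp
  then have "I = 0" by simp
  define c :: complex where "c = of_nat (Suc (3 * N) choose Suc (2 * N))"
  \<comment> \<open>As \<open>3 * N\<close> is even, the sign of \<open>cyc_coeff N i\<close> and
    that of \<open>(- u) ^ Suc (3 * N - i)\<close> multiply to -1 for every \<open>i\<close>; the
    unsigned coefficients add up by \<open>sum_choose_mult_choose\<close> with both lower entries
    \<open>N\<close>.\<close>
  have antidiagonal: "f u (- u) = - c * (1 / u ^ (3 * N + 2))" for u
  proof -
    have "f u (- u) = (\<Sum>i\<le>3 * N. - of_nat ((i choose N) * ((3 * N - i) choose N)) * (1 / u ^ (3 * N + 2)))"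
      unfolding f_full
    proof (intro sum.cong refl)
      fix i assume "i \<in> {..3 * N}"
      then have e: "3 * N + 2 = Suc i + Suc (3 * N - i)" by simp
      have p: "(1 / - u) ^ Suc (3 * N - i) = - ((-1) ^ i) * (1 / u) ^ Suc (3 * N - i)"
        using N(1) \<open>i \<in> {..3 * N}\<close> by (cases "even i") (auto simp: power_minus_odd power_minus_even minus_one_power_iff)
      show "cyc_coeff N i * ((1 / u) ^ Suc i * (1 / - u) ^ Suc (3 * N - i)) =
          - of_nat ((i choose N) * ((3 * N - i) choose N)) * (1 / u ^ (3 * N + 2))"
        unfolding p e power_add
        by (simp add: cyc_coeff_def minus_one_power_iff power_one_over divide_inverse power_inverse)
    qed
    also have "\<dots> = - of_nat (\<Sum>i\<le>3 * N. (i choose N) * ((3 * N - i) choose N)) * (1 / u ^ (3 * N + 2))"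
      by (simp only: sum_distrib_right of_nat_sum sum_negf[symmetric])
    also have "\<dots> = - c * (1 / u ^ (3 * N + 2))"
      unfolding sum_choose_mult_choose c_def by (simp add: mult_2)
    finally show ?thesis .
  qed
  have "((\<lambda>u. 1 / u ^ (3 * N + 2)) has_sum G (3 * N + 2)) S"
    unfolding G_def S_def by (rule has_sum_infsum[OF abs_summable_summable[OF summable]]) (use N in simp)
  then have "((\<lambda>u. f u (- u)) has_sum (- c * G (3 * N + 2))) S"
    unfolding antidiagonal by (rule has_sum_cmult_right)
  then have "((\<lambda>(u, v). f u v) has_sum (- c * G (3 * N + 2))) ((\<lambda>u. (u, - u)) ` S)"
    by (subst has_sum_reindex) (auto simp: inj_on_def o_def)
  \<comment> \<open>The pairs missing from \<open>T\<close> are exactly those with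
    \<open>v = - u\<close>, so the full double sum is \<open>I\<close> plus the antidiagonal
    part.\<close>
  then have "((\<lambda>(u, v). f u v) has_sum (I + - c * G (3 * N + 2))) (T \<union> (\<lambda>u. (u, - u)) ` S)"
    by (rule has_sum_Un_disjoint[OF I]) (auto simp: T_def)
  also have "T \<union> (\<lambda>u. (u, - u)) ` S = S \<times> S"
    using neg by (auto simp: T_def S_def image_iff add_eq_0_iff)
  finally have "I + - c * G (3 * N + 2) = R" using total by (rule has_sum_unique)
  then show ?thesis
    unfolding R_def[symmetric] c_def[symmetric] using \<open>I = 0\<close> by simp
qed

section \<open>The lattice spanned by z and 1\<close>

definition lattice :: "complex \<Rightarrow> complex set" where
  "lattice z = range (\<lambda>(m :: int, n :: int). of_int m * z + of_int n)"

lemma lattice_uminus: "u \<in> lattice z \<Longrightarrow> - u \<in> lattice z"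
proof -
  assume "u \<in> lattice z"
  then obtain m n :: int where "u = of_int m * z + of_int n" by (auto simp: lattice_def)
  then have "- u = of_int (- m) * z + of_int (- n)" by simp
  then show ?thesis unfolding lattice_def by (intro image_eqI[of _ _ "(- m, - n)"]) auto
qed

lemma lattice_add: "u \<in> lattice z \<Longrightarrow> v \<in> lattice z \<Longrightarrow> u + v \<in> lattice z"
proof -
  assume "u \<in> lattice z" "v \<in> lattice z"
  then obtain m n m' n' :: int where "u = of_int m * z + of_int n" "v = of_int m' * z + of_int n'"
    by (auto simp: lattice_def)
  then have "u + v = of_int (m + m') * z + of_int (n + n')" by (simp add: algebra_simps)
  then show ?thesis unfolding lattice_def by (intro image_eqI[of _ _ "(m + m', n + n')"]) auto
qed

text \<open>The imaginary part m * Im z determines m, and then the real part determines n. This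
  turns sums over index pairs into sums over lattice points.\<close>

lemma bij_betw_lattice:
  assumes "Im z > 0"
  shows "bij_betw (\<lambda>(m, n). of_int m * z + of_int n) ((UNIV :: (int \<times> int) set) - {(0, 0)}) (lattice z - {0})"
proof -
  have inj: "inj (\<lambda>(m :: int, n :: int). of_int m * z + of_int n)"
    using assms by (auto simp: inj_def complex_eq_iff)
  show ?thesis
    unfolding bij_betw_def image_set_diff[OF inj] lattice_def
    using inj_on_subset[OF inj] by simp
qed

lemma eisenstein_G_eq_lattice_sum:
  assumes "Im z > 0"
  shows "eisenstein_G w z = (\<Sum>\<^sub>\<infinity>u\<in>lattice z - {0}. 1 / u ^ w)"
  unfolding eisenstein_G_def infsum_reindex_bij_betw[OF bij_betw_lattice[OF assms], symmetric]
  by (simp add: split_def)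

lemma lattice_abs_summable:
  assumes "Im z > 0" "w \<ge> 3"
  shows "(\<lambda>u. norm (1 / u ^ w)) summable_on (lattice z - {0})"
  using eisenstein_abs_summable[OF assms]
  unfolding summable_on_reindex_bij_betw[OF bij_betw_lattice[OF assms(1)], symmetric]
  by (simp add: split_def)

section \<open>Matching the coefficients and the final formula\<close>

text \<open>For \<open>i = N + l\<close> the numerator on the right is \<open>cyc_coeff N i\<close>
  without its sign, since \<open>3 * N - i = 2 * N - l\<close>; the denominator is the factor of the
  weight \<open>3 * N + 2\<close> term in \<open>lattice_power_sum_relation\<close>. Writing all
  binomials by factorials, everything cancels.\<close>

lemma eisenstein_coefficient:
  fixes l N :: nat
  assumes "l \<le> N"
  shows "1 / of_nat (3 * N + 1) * (fact (2 * N + 1) / (fact N)\<^sup>2) *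
      (of_nat (N choose l) / of_nat ((3 * N) choose (N + l))) =
    (of_nat (((N + l) choose N) * ((2 * N - l) choose N)) / of_nat ((3 * N + 1) choose (2 * N + 1)) :: 'a::field_char_0)"
proof -
  have 1: "of_nat (N choose l) = (fact N / (fact l * fact (N - l)) :: 'a)"
    using assms by (simp add: binomial_fact)
  have 2: "of_nat ((3 * N) choose (N + l)) = (fact (3 * N) / (fact (N + l) * fact (2 * N - l)) :: 'a)"
    using binomial_fact[of "N + l" "3 * N", where 'a = 'a] assms by simp
  have 3: "of_nat ((N + l) choose N) = (fact (N + l) / (fact N * fact l) :: 'a)"
    using binomial_fact[of N "N + l", where 'a = 'a] by simp
  have 4: "of_nat ((2 * N - l) choose N) = (fact (2 * N - l) / (fact N * fact (N - l)) :: 'a)"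
    using binomial_fact[of N "2 * N - l", where 'a = 'a] assms by simp
  have 5: "of_nat ((3 * N + 1) choose (2 * N + 1)) =
      (of_nat (3 * N + 1) * fact (3 * N) / (fact (2 * N + 1) * fact N) :: 'a)"
    using binomial_fact[of "2 * N + 1" "3 * N + 1", where 'a = 'a] by (simp del: binomial_Suc_Suc)
  have "fact k \<noteq> (0 :: 'a)" for k by simp
  moreover have "of_nat (3 * N + 1) \<noteq> (0 :: 'a)" using of_nat_neq_0[of "3 * N"] by simp
  ultimately show ?thesis
    unfolding of_nat_mult 1 2 3 4 5
    by (simp add: field_simps power2_eq_square del: fact_Suc of_nat_add of_nat_Suc)
qed

theorem theorem1p6:
  fixes n :: nat and z :: complex
  assumes "n \<ge> 1" and "Im z > 0"
  shows "eisenstein_G (6 * n + 2) z =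
    1 / of_nat (6 * n + 1) * (fact (4 * n + 1) / (fact (2 * n))\<^sup>2) *
    (\<Sum>k = 1..n. of_nat ((2 * n) choose (2 * k - 1)) / of_nat ((6 * n) choose (2 * n + 2 * k - 1)) *
       eisenstein_G (2 * n + 2 * k) z * eisenstein_G (4 * n - 2 * k + 2) z)"
proof -
  define N where "N = 2 * n"
  define G where "G w = eisenstein_G w z" for w
  define C :: complex where "C = of_nat ((3 * N + 1) choose (2 * N + 1))"
  \<comment> \<open>The unsigned coefficient: for odd \<open>i\<close>, \<open>cyc_coeff N i\<close>
    is \<open>- b i\<close>, which matches the sign of \<open>- C\<close>.\<close>
  define b where "b i = (of_nat ((i choose N) * ((3 * N - i) choose N)) :: complex)" for i
  have "(3 * N + 1) choose (2 * N + 1) \<noteq> 0" by (simp only: binomial_eq_0_iff)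
  then have "C \<noteq> 0" unfolding C_def of_nat_eq_0_iff .
  have G_odd: "G w = 0" if "odd w" for w
    unfolding G_def eisenstein_G_eq_lattice_sum[OF assms(2)]
    using lattice_power_sum_odd_eq_0[OF lattice_uminus that] .
  have "even N" "N \<ge> 2" using assms(1) by (auto simp: N_def)
  from lattice_power_sum_relation[OF lattice_uminus lattice_add lattice_abs_summable[OF assms(2)] this]
  have "- C * G (3 * N + 2) = (\<Sum>i=N..2*N. cyc_coeff N i * (G (Suc i) * G (Suc (3 * N - i))))"
    unfolding G_def eisenstein_G_eq_lattice_sum[OF assms(2)] C_def by simp
  also have "\<dots> = (\<Sum>k=1..n. - b (N + 2 * k - 1) * (G (N + 2 * k) * G (4 * n - 2 * k + 2)))"
  proof -
    \<comment> \<open>An even \<open>i\<close> gives the odd weight \<open>i + 1\<close>, where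
      \<open>G\<close> vanishes; the odd \<open>i\<close> between the even bounds \<open>N\<close>
      and \<open>2 * N\<close> are the \<open>N + 2 * k - 1\<close>.\<close>
    have image: "(\<lambda>k. N + 2 * k - 1) ` {1..n} = {i \<in> {N..2*N}. odd i}"
    proof (intro equalityI subsetI)
      fix i assume "i \<in> {i \<in> {N..2*N}. odd i}"
      moreover from this obtain a where "i = 2 * a + 1" by (auto elim: oddE)
      \<comment> \<open>The witness solves 2a + 1 = 2n + 2k - 1 for k.\<close>
      ultimately show "i \<in> (\<lambda>k. N + 2 * k - 1) ` {1..n}"
        by (intro image_eqI[of _ _ "a + 1 - n"]) (auto simp: N_def)
    qed (auto simp: N_def)
    have "(\<Sum>i=N..2*N. cyc_coeff N i * (G (Suc i) * G (Suc (3 * N - i)))) =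
        (\<Sum>i\<in>{i \<in> {N..2*N}. odd i}. cyc_coeff N i * (G (Suc i) * G (Suc (3 * N - i))))"
      by (rule sum.mono_neutral_right) (auto simp: G_odd)
    also have "\<dots> = (\<Sum>k=1..n. - b (N + 2 * k - 1) * (G (N + 2 * k) * G (4 * n - 2 * k + 2)))"
      unfolding image[symmetric]
    proof (subst sum.reindex, unfold o_def, goal_cases)
      case 2
      show ?case
      proof (intro sum.cong refl)
        fix k assume "k \<in> {1..n}"
        then have "odd (N + 2 * k - 1)" "Suc (N + 2 * k - 1) = N + 2 * k"
          "Suc (3 * N - (N + 2 * k - 1)) = 4 * n - 2 * k + 2"
          by (auto simp: N_def)
        then show "cyc_coeff N (N + 2 * k - 1) * (G (Suc (N + 2 * k - 1)) * G (Suc (3 * N - (N + 2 * k - 1)))) =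
            - b (N + 2 * k - 1) * (G (N + 2 * k) * G (4 * n - 2 * k + 2))"
          by (simp only: cyc_coeff_def b_def minus_one_power_iff if_False mult_minus_left mult_1_left)
      qed
    qed (auto simp: inj_on_def)
    finally show ?thesis .
  qed
  also have "\<dots> = - C * (1 / of_nat (6 * n + 1) * (fact (4 * n + 1) / (fact (2 * n))\<^sup>2) *
    (\<Sum>k = 1..n. of_nat ((2 * n) choose (2 * k - 1)) / of_nat ((6 * n) choose (2 * n + 2 * k - 1)) *
       G (2 * n + 2 * k) * G (4 * n - 2 * k + 2)))"
    unfolding sum_distrib_left
  proof (intro sum.cong refl)
    fix k assume k: "k \<in> {1..n}"
    define l where "l = 2 * k - 1"
    have l: "l \<le> N" "N + 2 * k - 1 = N + l" "2 * n + 2 * k - 1 = N + l" "3 * N - (N + l) = 2 * N - l"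
      using k by (auto simp: l_def N_def)
    let ?p = "1 / of_nat (3 * N + 1) * (fact (2 * N + 1) / (fact N)\<^sup>2) :: complex"
    let ?q = "of_nat (N choose l) / of_nat ((3 * N) choose (N + l)) :: complex"
    have "b (N + l) = C * (?p * ?q)"
      unfolding eisenstein_coefficient[OF l(1)] using \<open>C \<noteq> 0\<close> by (simp add: b_def C_def l)
    then have "- b (N + l) * (G (N + 2 * k) * G (4 * n - 2 * k + 2)) =
        - C * (?p * (?q * G (N + 2 * k) * G (4 * n - 2 * k + 2)))"
      by (simp only: mult.assoc mult_minus_left)
    moreover have "3 * N = 6 * n" "2 * N = 4 * n" "2 * n = N" by (auto simp: N_def)
    ultimately show "- b (N + 2 * k - 1) * (G (N + 2 * k) * G (4 * n - 2 * k + 2)) =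
       - C * (1 / of_nat (6 * n + 1) * (fact (4 * n + 1) / (fact (2 * n))\<^sup>2) *
      (of_nat ((2 * n) choose (2 * k - 1)) / of_nat ((6 * n) choose (2 * n + 2 * k - 1)) *
       G (2 * n + 2 * k) * G (4 * n - 2 * k + 2)))"
      unfolding l l_def[symmetric] by (simp only:)
  qed
  finally have "G (3 * N + 2) = 1 / of_nat (6 * n + 1) * (fact (4 * n + 1) / (fact (2 * n))\<^sup>2) *
    (\<Sum>k = 1..n. of_nat ((2 * n) choose (2 * k - 1)) / of_nat ((6 * n) choose (2 * n + 2 * k - 1)) *
       G (2 * n + 2 * k) * G (4 * n - 2 * k + 2))"
    using \<open>C \<noteq> 0\<close> by (simp only: mult_cancel_left neg_equal_0_iff_equal simp_thms)
  moreover have "3 * N = 6 * n" by (simp add: N_def)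
  ultimately show ?thesis unfolding G_def by (simp only:)
qed

end
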